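(* The Okubic projective plane $\mathcal{O}P^{2}$ is isomorphic to the octonionic projective plane $\mathbb{O}P^{2}$; that is, there is a bijection from the points of $\mathcal{O}P^2$ to the points of $\mathbb{O}P^2$ and a bijection from the lines of $\mathcal{O}P^2$ to the lines of $\mathbb{O}P^2$ such that a point is incident to a line in $\mathcal{O}P^2$ if and only if the image point is incident to the image line in $\mathbb{O}P^2$.
   Context: The real Okubo algebra $\mathcal{O}$ is the 8-dimensional real vector space of $3\times 3$ complex Hermitian traceless matrices with bilinear product $x*y=\mu\,xy+\overline{\mu}\,yx-\frac13\mathrm{Tr}(xy)\,I$, where $\mu=\frac16(3+\mathrm{i}\sqrt3)$, juxtaposition is the matrix product and $I$ is the identity matrix. The octonions $\mathbb{O}$, with product $\cdot$, are the unique 8-dimensional unital composition division algebra over $\mathbb{R}$. For an algebra $A$ with product $\star$ (here $(A,\star)=(\mathcal{O},* )$ or $(\mathbb{O},\cdot)$) the projective plane over $A$ is described in affine coordinates, as the completed affine plane $\overline{\mathscr{A}_2}(A)$, as follows. Points: pairs $(x,y)\in A^2$; points at infinity $(s)$ with $s\in A$; and one further point $(\infty)$. Lines: for $s,t\in A$ the line $[s,t]=\{(x,s\star x+t):x\in A\}\cup\{(s)\}$; for $c\in A$ the vertical line $[c]=(\{c\}\times A)\cup\{(\infty)\}$; and the line at infinity $[\infty]=\{(s):s\in A\}\cup\{(\infty)\}$. Incidence is membership. $\mathcal{O}P^2$ denotes this plane for $(\mathcal{O},* )$ and $\mathbb{O}P^2$ this plane for $(\mathbb{O},\cdot)$. 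*)

theory Defs
  imports "HOL-Analysis.Analysis"
begin

section \<open>The completed affine plane over an algebra\<close>

text \<open>
  An algebra is given by its carrier \<open>A\<close> and its product \<open>m\<close>; addition is the one of
  the ambient type. Lines are sets of points, so that incidence is membership.
\<close>

datatype 'a plane_point = Affine 'a 'a | Slope 'a | Vertical

definition plane_points :: "'a set \<Rightarrow> 'a plane_point set" where
  "plane_points A = {Affine x y | x y. x \<in> A \<and> y \<in> A} \<union> Slope ` A \<union> {Vertical}"

definition sloped_line ::
    "'a::plus set \<Rightarrow> ('a \<Rightarrow> 'a \<Rightarrow> 'a) \<Rightarrow> 'a \<Rightarrow> 'a \<Rightarrow> 'a plane_point set" where
  "sloped_line A m s t = {Affine x (m s x + t) | x. x \<in> A} \<union> {Slope s}"

definition vertical_line :: "'a set \<Rightarrow> 'a \<Rightarrow> 'a plane_point set" where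
  "vertical_line A c = {Affine c y | y. y \<in> A} \<union> {Vertical}"

definition line_at_infinity :: "'a set \<Rightarrow> 'a plane_point set" where
  "line_at_infinity A = Slope ` A \<union> {Vertical}"

definition plane_lines ::
    "'a::plus set \<Rightarrow> ('a \<Rightarrow> 'a \<Rightarrow> 'a) \<Rightarrow> 'a plane_point set set" where
  "plane_lines A m =
     {sloped_line A m s t | s t. s \<in> A \<and> t \<in> A} \<union> vertical_line A ` A \<union> {line_at_infinity A}"

definition planes_isomorphic ::
    "'p set \<Rightarrow> 'p set set \<Rightarrow> 'q set \<Rightarrow> 'q set set \<Rightarrow> bool" where
  "planes_isomorphic P L P' L' \<longleftrightarrow>
     (\<exists>f g. bij_betw f P P' \<and> bij_betw g L L' \<and> (\<forall>p\<in>P. \<forall>l\<in>L. p \<in> l \<longleftrightarrow> f p \<in> g l))"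


section \<open>The real Okubo algebra\<close>

definition okubo :: "(complex^3^3) set" where
  "okubo = {x. (\<forall>i j. x $ i $ j = cnj (x $ j $ i)) \<and> trace x = 0}"

definition okubo_mu :: complex where
  "okubo_mu = (3 + \<i> * of_real (sqrt 3)) / 6"

definition okubo_mult :: "complex^3^3 \<Rightarrow> complex^3^3 \<Rightarrow> complex^3^3" where
  "okubo_mult x y =
     (\<chi> i j. okubo_mu * (x ** y) $ i $ j + cnj okubo_mu * (y ** x) $ i $ j
             - trace (x ** y) / 3 * (mat 1 :: complex^3^3) $ i $ j)"

lemma mat3_nth:
  fixes x y :: "complex^3^3"
  shows "(x ** y) $ i $ j = x$i$1 * y$1$j + x$i$2 * y$2$j + x$i$3 * y$3$j"
  by (simp add: matrix_matrix_mult_def sum_3)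

lemma trace3: "trace (x :: complex^3^3) = x$1$1 + x$2$2 + x$3$3"
  by (simp add: trace_def sum_3)

lemma okuboD:
  assumes "x \<in> okubo"
  shows "cnj (x $ i $ j) = x $ j $ i" "trace x = 0"
  using assms unfolding okubo_def by (metis (mono_tags, lifting) mem_Collect_eq)+

lemma okuboI:
  assumes "\<And>i j. cnj (x $ i $ j) = x $ j $ i" "trace x = 0"
  shows "x \<in> okubo"
  unfolding okubo_def using assms(1)[symmetric] assms(2) by blast

lemma subspace_okubo: "subspace okubo"
proof (rule subspaceI)
  show "0 \<in> okubo"
    by (simp add: okubo_def trace_def)
  show "x + y \<in> okubo" if "x \<in> okubo" "y \<in> okubo" for x y
    using that by (intro okuboI) (simp_all add: okuboD trace_add)
  show "c *\<^sub>R x \<in> okubo" if x: "x \<in> okubo" for c x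
  proof (rule okuboI)
    have "trace (c *\<^sub>R x) = c *\<^sub>R trace x"
      by (simp add: trace_def scaleR_sum_right)
    then show "trace (c *\<^sub>R x) = 0"
      by (simp add: okuboD[OF x])
  qed (simp add: okuboD[OF x])
qed

lemma okubo_mult_closed:
  assumes "x \<in> okubo" "y \<in> okubo"
  shows "okubo_mult x y \<in> okubo"
proof -
  have x: "cnj (x $ i $ j) = x $ j $ i" and y: "cnj (y $ i $ j) = y $ j $ i" for i j
    using assms by (simp_all add: okuboD)
  have cnj_mult: "cnj ((x ** y) $ i $ j) = (y ** x) $ j $ i"
      "cnj ((y ** x) $ i $ j) = (x ** y) $ j $ i" for i j
    by (simp_all add: mat3_nth x y mult.commute)
  have tr: "trace (y ** x) = trace (x ** y)"
    by (rule trace_mul_sym)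
  have cnj_tr: "cnj (trace (x ** y)) = trace (x ** y)"
    using tr by (simp add: trace3 cnj_mult)
  have "cnj (okubo_mult x y $ i $ j) = okubo_mult x y $ j $ i" for i j
    by (simp add: okubo_mult_def cnj_mult cnj_tr mat_def)
  moreover have "okubo_mu + cnj okubo_mu = 1"
    by (simp add: okubo_mu_def complex_eq_iff)
  then have "trace (okubo_mult x y) = 0"
  proof -
    have "trace (okubo_mult x y)
        = okubo_mu * trace (x ** y) + cnj okubo_mu * trace (y ** x) - trace (x ** y)"
      by (simp add: trace3 okubo_mult_def mat_def algebra_simps)
    also have "\<dots> = (okubo_mu + cnj okubo_mu) * trace (x ** y) - trace (x ** y)"
      by (simp add: tr algebra_simps)
    finally show ?thesis
      using \<open>okubo_mu + cnj okubo_mu = 1\<close> by simp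
  qed
  ultimately show ?thesis
    by (rule okuboI)
qed

lemma dim_okubo: "dim okubo = 8"
proof -
  define F :: "(complex \<times> complex) \<times> (complex \<times> complex) \<Rightarrow> complex^3^3" where
    "F = (\<lambda>((a, b), (c, d)).
       vector [vector [of_real (Re a), b, c],
               vector [cnj b, of_real (Im a), d],
               vector [cnj c, cnj d, - of_real (Re a + Im a)]])"
  have lin: "linear F"
    by (rule linearI)
       (auto simp: F_def vec_eq_iff forall_3 vector_3 complex_eq_iff algebra_simps)
  moreover have "inj F"
    unfolding linear_injective_0[OF lin]
    by (auto simp: F_def vec_eq_iff forall_3 vector_3 complex_eq_iff zero_prod_def)
  moreover have "range F = okubo"
  proof
    show "range F \<subseteq> okubo"
      by (auto simp: F_def okubo_def trace3 forall_3 vector_3)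
    show "okubo \<subseteq> range F"
    proof
      fix x assume x: "x \<in> okubo"
      have h: "cnj (x $ i $ j) = x $ j $ i" for i j
        using x by (simp add: okuboD)
      have re: "of_real (Re (x $ i $ i)) = x $ i $ i" for i
        using h[of i i] by (simp add: complex_eq_iff)
      have "x $ 3 $ 3 = - x $ 1 $ 1 - x $ 2 $ 2"
        using okuboD(2)[OF x] by (simp add: trace3 add_eq_0_iff algebra_simps)
      then have "F ((Complex (Re (x$1$1)) (Re (x$2$2)), x$1$2), (x$1$3, x$2$3)) = x"
        by (simp add: F_def vec_eq_iff forall_3 vector_3 re h)
      then show "x \<in> range F" by (metis rangeI)
    qed
  qed
  ultimately have "dim okubo = dim (UNIV :: ((complex \<times> complex) \<times> (complex \<times> complex)) set)"
    using dim_image_eq[OF lin, of UNIV] by (simp add: inj_on_def)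
  then show ?thesis by simp
qed


section \<open>The octonions\<close>

text \<open>
  Two Cayley-Dickson doublings \<open>(a, b) (c, d) = (a c - d\<^sup>* b, d a + b c\<^sup>*)\<close> starting from the
  complex numbers. The vector space structure and the Euclidean norm are those of the
  product type. The lemmas below show that the result is a unital composition division
  algebra of dimension 8, with quadratic form \<open>(norm x)\<^sup>2\<close>.
\<close>

type_synonym quaternion = "complex \<times> complex"
type_synonym octonion = "quaternion \<times> quaternion"

fun quat_mult :: "quaternion \<Rightarrow> quaternion \<Rightarrow> quaternion" where
  "quat_mult (a, b) (c, d) = (a * c - cnj d * b, d * a + b * cnj c)"

fun quat_cnj :: "quaternion \<Rightarrow> quaternion" where
  "quat_cnj (a, b) = (cnj a, - b)"

fun oct_mult :: "octonion \<Rightarrow> octonion \<Rightarrow> octonion" where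
  "oct_mult (a, b) (c, d) =
     (quat_mult a c - quat_mult (quat_cnj d) b, quat_mult d a + quat_mult b (quat_cnj c))"

definition oct_one :: octonion where
  "oct_one = ((1, 0), (0, 0))"

lemma DIM_octonion: "DIM(octonion) = 8"
  by simp

lemma oct_mult_one: "oct_mult oct_one x = x" "oct_mult x oct_one = x"
  by (cases x; force simp: oct_one_def)+

lemma oct_mult_linear: "linear (oct_mult x)" "linear (\<lambda>y. oct_mult y x)"
proof -
  obtain a b c d where "x = ((a, b), (c, d))"
    by (metis surj_pair)
  then show "linear (oct_mult x)" "linear (\<lambda>y. oct_mult y x)"
    by (auto intro!: linearI simp: algebra_simps)
qed

lemma quat_norm_mult: "(norm (quat_mult p q))\<^sup>2 = (norm p)\<^sup>2 * (norm q)\<^sup>2"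
proof -
  obtain a b c d where "p = (a, b)" "q = (c, d)" by (metis surj_pair)
  then show ?thesis
    by (simp add: norm_Pair cmod_power2) (simp add: power2_eq_square algebra_simps)
qed

lemma norm_quat_cnj: "norm (quat_cnj p) = norm p"
  by (cases p) (simp add: norm_Pair)

lemma inner_quat_mult:
  "quat_mult a c \<bullet> quat_mult (quat_cnj d) b = quat_mult d a \<bullet> quat_mult b (quat_cnj c)"
proof -
  obtain a1 a2 b1 b2 c1 c2 d1 d2 where "a = (a1, a2)" "b = (b1, b2)" "c = (c1, c2)" "d = (d1, d2)"
    by (metis surj_pair)
  then show ?thesis
    by (simp add: inner_complex_def algebra_simps)
qed

lemma oct_norm_mult: "norm (oct_mult x y) = norm x * norm y"
proof -
  obtain a b where x: "x = (a, b)" by (metis surj_pair)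
  obtain c d where y: "y = (c, d)" by (metis surj_pair)
  have minus: "(norm (u - v))\<^sup>2 = (norm u)\<^sup>2 + (norm v)\<^sup>2 - 2 * (u \<bullet> v)"
    and plus: "(norm (u + v))\<^sup>2 = (norm u)\<^sup>2 + (norm v)\<^sup>2 + 2 * (u \<bullet> v)" for u v :: quaternion
    by (simp_all add: power2_norm_eq_inner inner_diff inner_add inner_commute)
  have "(norm (oct_mult x y))\<^sup>2 = (norm x)\<^sup>2 * (norm y)\<^sup>2"
    by (simp add: x y norm_Pair minus plus quat_norm_mult norm_quat_cnj inner_quat_mult)
       (simp add: algebra_simps)
  then have "(norm (oct_mult x y))\<^sup>2 = (norm x * norm y)\<^sup>2"
    by (simp add: power_mult_distrib)
  then show ?thesis
    by (simp add: power2_eq_iff_nonneg)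
qed

lemma oct_division:
  assumes "a \<noteq> 0"
  shows "\<exists>!x. oct_mult a x = b" "\<exists>!x. oct_mult x a = b"
proof -
  have "x = 0" if "oct_mult a x = 0 \<or> oct_mult x a = 0" for x
  proof -
    have "norm a * norm x = 0"
      using that by (metis mult.commute norm_zero oct_norm_mult)
    then show ?thesis
      using assms by simp
  qed
  then have "inj (oct_mult a)" "inj (\<lambda>x. oct_mult x a)"
    unfolding linear_injective_0[OF oct_mult_linear(1)] linear_injective_0[OF oct_mult_linear(2)]
    by blast+
  then have "bij (oct_mult a)" "bij (\<lambda>x. oct_mult x a)"
    unfolding bij_def using linear_inj_imp_surj oct_mult_linear by blast+
  then show "\<exists>!x. oct_mult a x = b" "\<exists>!x. oct_mult x a = b"
    unfolding bij_iff by blast+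
qed

end

theory Submission
  imports Defs
begin

text \<open>
  The two algebras are not isomorphic, as the Okubo algebra has no unit, but an isomorphism of
  planes asks for less. The slope \<open>s\<close>, the abscissa \<open>x\<close> and the ordinate \<open>s \<star> x + t\<close> play
  different roles in the equation of a line, so each may be transported by a bijection of its
  own: if \<open>\<gamma> (s \<star> x) = \<alpha> s \<cdot> \<beta> x\<close> and \<open>\<gamma>\<close> is additive, then \<open>(x, y) \<mapsto> (\<beta> x, \<gamma> y)\<close>,
  \<open>(s) \<mapsto> (\<alpha> s)\<close> maps lines onto lines (\<open>planes_isomorphic_if_isotopic\<close>). Such a triple is an
  isotopy of the algebras.

  An isotopy is found by Kaplansky's trick. The Okubo product is multiplicative for the quadratic
  form \<open>Tr (x\<^sup>2) / 6\<close>, and \<open>e = diag (2, -1, -1)\<close> is an idempotent of norm 1. The maps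
  \<open>R x = x * e\<close> and \<open>L x = e * x\<close> are bijective, and the product determined by
  \<open>R x \<cdot> L y = x * y\<close> is again multiplicative for that form and has the unit \<open>e\<close>. Being
  positive definite, it must be the octonion product. The map \<open>okubo_of_oct\<close> is an explicit such
  identification, under which \<open>R\<close> and \<open>L\<close> become the coordinatewise maps \<open>oct_twist\<close>; all that remains
  of the argument is then the polynomial identity \<open>okubo_mult_okubo_of_oct\<close>.
\<close>

section \<open>Isotopic algebras have isomorphic planes\<close>

fun plane_map ::
    "('a \<Rightarrow> 'b) \<Rightarrow> ('a \<Rightarrow> 'b) \<Rightarrow> ('a \<Rightarrow> 'b) \<Rightarrow> 'a plane_point \<Rightarrow> 'b plane_point" where
  "plane_map \<alpha> \<beta> \<gamma> (Affine x y) = Affine (\<beta> x) (\<gamma> y)"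
| "plane_map \<alpha> \<beta> \<gamma> (Slope s) = Slope (\<alpha> s)"
| "plane_map \<alpha> \<beta> \<gamma> Vertical = Vertical"

lemma plane_map_bij_betw:
  assumes "bij_betw \<alpha> A A'" "bij_betw \<beta> A A'" "bij_betw \<gamma> A A'"
  shows "bij_betw (plane_map \<alpha> \<beta> \<gamma>) (plane_points A) (plane_points A')"
proof -
  have im: "\<alpha> ` A = A'" "\<beta> ` A = A'" "\<gamma> ` A = A'"
    and inj: "inj_on \<alpha> A" "inj_on \<beta> A" "inj_on \<gamma> A"
    using assms by (auto simp: bij_betw_def)
  have "inj_on (plane_map \<alpha> \<beta> \<gamma>) (plane_points A)"
    using inj by (auto simp: inj_on_def plane_points_def)
  moreover have "plane_map \<alpha> \<beta> \<gamma> ` plane_points A = plane_points A'"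
  proof -
    have "plane_map \<alpha> \<beta> \<gamma> ` {Affine x y |x y. x \<in> A \<and> y \<in> A}
        = {Affine x y |x y. x \<in> \<beta> ` A \<and> y \<in> \<gamma> ` A}"
      by (auto simp: image_iff) (metis plane_map.simps(1))
    then show ?thesis
      by (simp add: plane_points_def image_Un im) (simp add: image_image flip: im(1))
  qed
  ultimately show ?thesis
    by (simp add: bij_betw_def)
qed

text \<open>
  Injectivity of a map of points passes to lines only because every line consists of points of
  the plane.
\<close>

lemma plane_lines_subset:
  fixes A :: "'a::plus set"
  assumes "\<And>x y. x \<in> A \<Longrightarrow> y \<in> A \<Longrightarrow> x + y \<in> A"
    and "\<And>x y. x \<in> A \<Longrightarrow> y \<in> A \<Longrightarrow> m x y \<in> A"
    and "l \<in> plane_lines A m"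
  shows "l \<subseteq> plane_points A"
  using assms
  by (auto simp: plane_lines_def plane_points_def sloped_line_def vertical_line_def
      line_at_infinity_def)

text \<open>
  The line with slope \<open>s\<close> and intercept \<open>t\<close> goes to the one with slope \<open>\<alpha> s\<close> and intercept
  \<open>\<gamma> t\<close>, because \<open>\<gamma> (m s x + t) = m' (\<alpha> s) (\<beta> x) + \<gamma> t\<close> and \<open>\<beta> x\<close> runs through \<open>A'\<close>. Taking
  images of lines is injective and reflects incidence since the map of points is injective.
\<close>

lemma planes_isomorphic_if_isotopic:
  fixes A :: "'a::plus set" and A' :: "'b::plus set"
  assumes bij: "bij_betw \<alpha> A A'" "bij_betw \<beta> A A'" "bij_betw \<gamma> A A'"
    and plus_closed: "\<And>x y. x \<in> A \<Longrightarrow> y \<in> A \<Longrightarrow> x + y \<in> A"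
    and mult_closed: "\<And>x y. x \<in> A \<Longrightarrow> y \<in> A \<Longrightarrow> m x y \<in> A"
    and plus: "\<And>x y. x \<in> A \<Longrightarrow> y \<in> A \<Longrightarrow> \<gamma> (x + y) = \<gamma> x + \<gamma> y"
    and mult: "\<And>x y. x \<in> A \<Longrightarrow> y \<in> A \<Longrightarrow> \<gamma> (m x y) = m' (\<alpha> x) (\<beta> y)"
  shows "planes_isomorphic (plane_points A) (plane_lines A m)
           (plane_points A') (plane_lines A' m')"
proof -
  let ?f = "plane_map \<alpha> \<beta> \<gamma>"
  have f: "bij_betw ?f (plane_points A) (plane_points A')"
    using bij by (rule plane_map_bij_betw)
  have sub: "l \<subseteq> plane_points A" if "l \<in> plane_lines A m" for l
    using plus_closed mult_closed that by (rule plane_lines_subset)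
  have im: "\<alpha> ` A = A'" "\<beta> ` A = A'" "\<gamma> ` A = A'"
    using bij by (auto simp: bij_betw_def)
  have sloped: "?f ` sloped_line A m s t = sloped_line A' m' (\<alpha> s) (\<gamma> t)"
    if "s \<in> A" "t \<in> A" for s t
  proof -
    have "?f ` {Affine x (m s x + t) |x. x \<in> A}
        = {Affine (\<beta> x) (m' (\<alpha> s) (\<beta> x) + \<gamma> t) |x. x \<in> A}"
      using that by (auto simp: Setcompr_eq_image image_image plus mult mult_closed cong: image_cong)
    also have "\<dots> = {Affine x (m' (\<alpha> s) x + \<gamma> t) |x. x \<in> A'}"
      unfolding im(2)[symmetric] by blast
    finally show ?thesis
      by (simp add: sloped_line_def)
  qed
  have vertical: "?f ` vertical_line A c = vertical_line A' (\<beta> c)" for c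
    by (simp add: vertical_line_def Setcompr_eq_image image_image flip: im(3))
  have infinity: "?f ` line_at_infinity A = line_at_infinity A'"
    by (simp add: line_at_infinity_def image_image flip: im(1))
  have lines: "plane_lines B n = (\<lambda>(s, t). sloped_line B n s t) ` (B \<times> B)
      \<union> vertical_line B ` B \<union> {line_at_infinity B}" for B :: "'c::plus set" and n
    by (auto simp: plane_lines_def)
  have "image ?f ` plane_lines A m = plane_lines A' m'"
  proof -
    have "image ?f ` (\<lambda>(s, t). sloped_line A m s t) ` (A \<times> A)
        = (\<lambda>(s, t). sloped_line A' m' s t) ` map_prod \<alpha> \<gamma> ` (A \<times> A)"
      unfolding image_image by (rule image_cong) (simp, clarsimp simp: sloped)
    then have "image ?f ` (\<lambda>(s, t). sloped_line A m s t) ` (A \<times> A)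
        = (\<lambda>(s, t). sloped_line A' m' s t) ` (A' \<times> A')"
      by (simp only: map_prod_surj_on[OF im(1,3)])
    moreover have "image ?f ` vertical_line A ` A = vertical_line A' ` A'"
      by (simp add: image_image vertical flip: im(2))
    ultimately show ?thesis
      by (simp only: lines image_Un image_insert image_empty infinity)
  qed
  moreover have "inj_on (image ?f) (plane_lines A m)"
    using sub f unfolding bij_betw_def
    by (intro inj_onI) (metis inj_on_image_eq_iff)
  ultimately have "bij_betw (image ?f) (plane_lines A m) (plane_lines A' m')"
    by (simp add: bij_betw_def)
  moreover have "p \<in> l \<longleftrightarrow> ?f p \<in> ?f ` l"
    if "p \<in> plane_points A" "l \<in> plane_lines A m" for p l
    using that sub f unfolding bij_betw_def by (metis inj_on_image_mem_iff)
  ultimately show ?thesis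
    using f unfolding planes_isomorphic_def by blast
qed


section \<open>An isotopy between the Okubo algebra and the octonions\<close>

text \<open>
  The octonions have the basis \<open>1, i, j, ij, l, il, jl, (ij)l\<close>. Here \<open>1\<close> goes to the idempotent
  \<open>e\<close>, and \<open>i\<close>, \<open>j\<close>, \<open>l\<close> go to \<open>\<surd>3 (E\<^sub>2\<^sub>2 - E\<^sub>3\<^sub>3)\<close>, \<open>\<surd>3 (E\<^sub>1\<^sub>2 + E\<^sub>2\<^sub>1)\<close>,
  \<open>\<surd>3 (E\<^sub>2\<^sub>3 + E\<^sub>3\<^sub>2)\<close>, which are of norm 1 and orthogonal to \<open>e\<close> and to each other for
  \<open>Tr (x\<^sup>2) / 6\<close>, with \<open>l\<close> also orthogonal to \<open>ij\<close>. The other values are forced by multiplicativity for the unital product of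
  Kaplansky's trick; in particular \<open>jl\<close> yields the factor \<open>- \<i>\<close> in the corner.
\<close>

fun okubo_of_oct :: "octonion \<Rightarrow> complex^3^3" where
  "okubo_of_oct ((a, b), (c, d)) =
     (let r = complex_of_real (sqrt 3); p = of_real (Re a); q = r * of_real (Im a) in
      vector [vector [2 * p, r * b, - \<i> * r * d],
              vector [r * cnj b, q - p, r * c],
              vector [\<i> * r * cnj d, r * cnj c, - p - q]])"

text \<open>
  For \<open>w\<close> the sixth root of unity \<open>root6\<close> and its conjugate, these are the maps \<open>x \<mapsto> e * x\<close> and
  \<open>x \<mapsto> x * e\<close> in octonion coordinates. The Okubo product with \<open>e\<close> scales an entry in
  position \<open>(1, 2)\<close> or \<open>(1, 3)\<close> by \<open>2 \<mu> - cnj \<mu> = root6\<close> or its conjugate and the entry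
  \<open>(2, 3)\<close> by \<open>- \<mu> - cnj \<mu> = -1\<close>, and it swaps the diagonal entries \<open>(2, 2)\<close> and \<open>(3, 3)\<close>.
\<close>

fun oct_twist :: "complex \<Rightarrow> octonion \<Rightarrow> octonion" where
  "oct_twist w ((a, b), (c, d)) = ((cnj a, w * b), (- c, w * d))"

definition root6 :: complex where
  "root6 = (1 + \<i> * of_real (sqrt 3)) / 2"

text \<open>
  Kaplansky's identity \<open>x * y = (x * e) \<cdot> (e * y)\<close>, written in octonion coordinates. Comparing real
  and imaginary parts of the matrix entries leaves polynomial identities over the rationals
  extended by \<open>sqrt 3\<close>.
\<close>

lemma okubo_mult_okubo_of_oct:
  "okubo_mult (okubo_of_oct x) (okubo_of_oct y)
     = okubo_of_oct (oct_mult (oct_twist (cnj root6) x) (oct_twist root6 y))"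
proof -
  obtain a b c d where x: "x = ((a, b), (c, d))" by (metis surj_pair)
  obtain a' b' c' d' where y: "y = ((a', b'), (c', d'))" by (metis surj_pair)
  obtain r where r: "r = sqrt 3" by blast
  have rr: "r * r = 3" "r * (r * z) = 3 * z" for z
    by (simp_all add: r flip: mult.assoc)
  show ?thesis
    unfolding x y
    by (simp add: vec_eq_iff forall_3 okubo_mult_def mat3_nth trace3 mat_def vector_3 Let_def
          complex_eq_iff okubo_mu_def root6_def flip: r,
        intro conjI,
        \<comment> \<open>Distributing the divisions keeps the sums from being cross-multiplied, which would blow up
          their size before the powers of \<open>r\<close> are reduced.\<close>
        simp_all only: algebra_simps add_divide_distrib diff_divide_distrib
          times_divide_eq_right times_divide_eq_left divide_divide_eq_left minus_divide_left,
        simp_all add: rr,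
        simp_all add: algebra_simps rr)
qed

lemma linear_okubo_of_oct: "linear okubo_of_oct"
  by (rule linearI)
    (auto simp: vec_eq_iff forall_3 vector_3 Let_def complex_eq_iff algebra_simps)

lemma inj_okubo_of_oct: "inj okubo_of_oct"
  unfolding linear_injective_0[OF linear_okubo_of_oct]
  by (auto simp: vec_eq_iff forall_3 vector_3 Let_def complex_eq_iff zero_prod_def)

lemma range_okubo_of_oct: "range okubo_of_oct = okubo"
proof (rule subspace_dim_equal)
  show "subspace (range okubo_of_oct)"
    using linear_okubo_of_oct by (simp add: linear_subspace_image)
  show "range okubo_of_oct \<subseteq> okubo"
    by (auto simp: okubo_def trace3 forall_3 vector_3 Let_def)
  have "dim (range okubo_of_oct) = dim (UNIV :: octonion set)"
    using linear_okubo_of_oct inj_okubo_of_oct by (rule dim_image_eq[OF _ inj_on_subset]) simp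
  then show "dim (range okubo_of_oct) \<ge> dim okubo"
    by (simp add: dim_okubo)
qed (rule subspace_okubo)

lemma bij_oct_twist:
  assumes "w \<noteq> 0"
  shows "bij (oct_twist w)"
proof (rule o_bij)
  show "oct_twist (inverse w) \<circ> oct_twist w = id" "oct_twist w \<circ> oct_twist (inverse w) = id"
    using assms by (auto simp: fun_eq_iff)
qed

theorem theorem24:
  shows "planes_isomorphic
           (plane_points okubo) (plane_lines okubo okubo_mult)
           (plane_points (UNIV :: octonion set)) (plane_lines (UNIV :: octonion set) oct_mult)"
proof (rule planes_isomorphic_if_isotopic[where \<alpha> = "oct_twist (cnj root6) \<circ> inv okubo_of_oct"
      and \<beta> = "oct_twist root6 \<circ> inv okubo_of_oct" and \<gamma> = "inv okubo_of_oct"])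
  let ?G = "inv okubo_of_oct"
  have "root6 \<noteq> 0"
    by (simp add: root6_def complex_eq_iff)
  then have twist: "bij (oct_twist root6)" "bij (oct_twist (cnj root6))"
    by (simp_all add: bij_oct_twist)
  show G: "bij_betw ?G okubo UNIV"
    using bij_betw_inv_into[OF inj_on_imp_bij_betw[OF inj_okubo_of_oct]]
    by (simp add: range_okubo_of_oct)
  show "bij_betw (oct_twist (cnj root6) \<circ> ?G) okubo UNIV" "bij_betw (oct_twist root6 \<circ> ?G) okubo UNIV"
    using G twist by (blast intro: bij_betw_trans)+
  have inv: "?G (okubo_of_oct u) = u" for u
    by (simp add: inj_okubo_of_oct)
  fix x y assume "x \<in> okubo" "y \<in> okubo"
  then obtain u v where uv: "x = okubo_of_oct u" "y = okubo_of_oct v"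
    by (metis range_okubo_of_oct rangeE)
  show "x + y \<in> okubo"
    using \<open>x \<in> okubo\<close> \<open>y \<in> okubo\<close> by (rule subspace_add[OF subspace_okubo])
  show "okubo_mult x y \<in> okubo"
    using \<open>x \<in> okubo\<close> \<open>y \<in> okubo\<close> by (rule okubo_mult_closed)
  show "?G (x + y) = ?G x + ?G y"
    unfolding uv inv by (simp add: inv flip: linear_add[OF linear_okubo_of_oct])
  show "?G (okubo_mult x y)
      = oct_mult ((oct_twist (cnj root6) \<circ> ?G) x) ((oct_twist root6 \<circ> ?G) y)"
    unfolding uv by (simp add: okubo_mult_okubo_of_oct inv)
qed

end
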